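(* There is a constant $c$ such that for all integers $k \geq 2$, $$T_k \leq c\, k^2 \log k.$$
   Context: For a positive integer $n$, $[n]=\{1,\dots,n\}$; $\log$ denotes the natural logarithm. In a coloring of $[n]$, an arithmetic progression is rainbow if its elements all have different colors. A $k$-term arithmetic progression is a set $\{a,a+d,\dots,a+(k-1)d\}$ with $d\ge 1$. An equinumerous $t$-coloring of $[tm]$ is a coloring with $t$ colors in which each color is used exactly $m$ times. $T_k$ denotes the smallest positive integer $t$ such that, for every positive integer $m$, every equinumerous $t$-coloring of $[tm]$ contains a rainbow $k$-term arithmetic progression. *)

theory Defs
  imports Complex_Main "HOL-Library.Extended_Nat" "HOL-Library.Extended_Real"
begin

definition arith_prog :: "nat \<Rightarrow> nat set \<Rightarrow> bool" where
  "arith_prog k A \<longleftrightarrow> (\<exists>a d. d \<ge> 1 \<and> A = {a + i * d | i. i < k})"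

definition rainbow :: "(nat \<Rightarrow> nat) \<Rightarrow> nat set \<Rightarrow> bool" where
  "rainbow \<chi> A \<longleftrightarrow> inj_on \<chi> A"

(* A colouring of {1..t*m} with palette {1..t}; values of \<chi> outside {1..t*m} are irrelevant. *)
definition equinumerous_coloring :: "nat \<Rightarrow> nat \<Rightarrow> (nat \<Rightarrow> nat) \<Rightarrow> bool" where
  "equinumerous_coloring t m \<chi> \<longleftrightarrow>
     (\<forall>x \<in> {1..t * m}. \<chi> x \<in> {1..t}) \<and>
     (\<forall>j \<in> {1..t}. card {x \<in> {1..t * m}. \<chi> x = j} = m)"

definition forces_rainbow_AP :: "nat \<Rightarrow> nat \<Rightarrow> bool" where
  "forces_rainbow_AP k t \<longleftrightarrow>
     (\<forall>m \<ge> 1. \<forall>\<chi>. equinumerous_coloring t m \<chi> \<longrightarrow>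
        (\<exists>A. A \<subseteq> {1..t * m} \<and> arith_prog k A \<and> rainbow \<chi> A))"

(* The infimum is the minimum when the set is nonempty, and \<infinity> when it is empty.
   Hence a finite upper bound on T k also asserts that some such t exists. *)
definition T :: "nat \<Rightarrow> enat" where
  "T k = Inf {enat t | t. t \<ge> 1 \<and> forces_rainbow_AP k t}"

end

theory Submission
  imports Defs "HOL-Computational_Algebra.Primes" "HOL-Analysis.Harmonic_Numbers"
begin

text \<open>A crude count already gives a bound of order \<open>k\<^sup>3\<close>: with \<open>n = t * m\<close>, there are about \<open>n\<^sup>2 / (2 * k)\<close>
  progressions of length \<open>k\<close> in \<open>{1..n}\<close>, there are at most \<open>n * m\<close> pairs of equally coloured points,
  and each pair lies in at most \<open>k\<^sup>2\<close> progressions. The loss is in the last step, where a pair at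
  distance \<open>e\<close> is charged once for every \<open>s < k\<close> dividing \<open>e\<close> and every position.

  Only progressions whose difference \<open>d\<close> has no prime factor \<open>\<le> k\<close> are therefore used. If \<open>e = s * d\<close> with
  \<open>s < k\<close>, then \<open>s\<close> and \<open>d\<close> are determined by \<open>e\<close>: all primes in \<open>s\<close> are at most \<open>k\<close> and all primes
  in \<open>d\<close> exceed \<open>k\<close>. A pair now spoils at most \<open>k\<close> progressions, one for each position of its smaller
  point (\<open>card_sifted_upper_if_no_rainbow\<close>). The price is the density of the admissible differences.
  By \<open>card_sifted_primes_lower\<close> at least a constant times \<open>x / ln k\<close> of the integers up to \<open>x\<close> are admissible,
  uniformly in \<open>x \<ge> 3 ^ 7 * k\<close>. Comparing \<open>n\<^sup>2 / (k * ln k)\<close> progressions with \<open>k * n * m\<close> spoiled ones,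
  up to constants, shows that \<open>t\<close> of order \<open>k\<^sup>2 * ln k\<close> suffices.

  The number of integers free of primes \<open>\<le> k\<close> is bounded below through logarithms of their prime factors.
  Let \<open>F\<close> be the set of these integers. Summing \<open>ln d\<close> over \<open>d \<in> F\<close> with \<open>d \<le> x\<close>, and keeping in each \<open>ln d\<close>
  only the logarithms of the prime factors, gives at least the sum over \<open>m \<in> F\<close> of all \<open>ln p\<close> with
  \<open>k < p \<le> x / m\<close>. By a Chebyshev estimate this is at least a constant times \<open>x / m\<close>, as long as \<open>m\<close> is
  at most \<open>x / (3 ^ 7 * k)\<close> (\<open>sifted_primes_log_sum_lower\<close>). What remains is the sum of \<open>1 / m\<close> over \<open>m \<in> F\<close>
  up to that limit. It is at least the product of \<open>1 - 1 / p\<close> over \<open>p \<le> k\<close> times a harmonic number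
  (\<open>sifted_harmonic_lower\<close>), and that product has order at least \<open>1 / ln k\<close> by Mertens
  (\<open>mertens_product_lower\<close>). The estimates of Chebyshev and Mertens are derived from the prime
  factorisations of \<open>n!\<close> and of the central binomial coefficients.\<close>

section \<open>Chebyshev and Mertens estimates\<close>

definition primes_upto :: "nat \<Rightarrow> nat set" where
  "primes_upto n = {p. prime p \<and> p \<le> n}"

lemma finite_primes_upto [simp, intro]: "finite (primes_upto n)"
  by (rule finite_subset[of _ "{..n}"]) (auto simp: primes_upto_def)

lemma primes_uptoD: "p \<in> primes_upto n \<Longrightarrow> prime p \<and> 2 \<le> p \<and> p \<le> n"
  by (auto simp: primes_upto_def prime_ge_2_nat)

lemma primes_upto_mono: "m \<le> n \<Longrightarrow> primes_upto m \<subseteq> primes_upto n"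
  by (auto simp: primes_upto_def)

lemma primes_upto_Suc:
  "primes_upto (Suc n) = (if prime (Suc n) then insert (Suc n) (primes_upto n) else primes_upto n)"
  by (auto simp: primes_upto_def le_Suc_eq)

lemma prod_primes_dvd:
  assumes "finite P" "\<And>p. p \<in> P \<Longrightarrow> prime (p::nat)" "\<And>p. p \<in> P \<Longrightarrow> p dvd n"
  shows "\<Prod>P dvd n"
  using assms
proof (induction P)
  case (insert p P)
  have "coprime p (\<Prod>P)"
    by (rule prod_coprime_right) (use insert in \<open>auto intro: primes_coprime\<close>)
  then show ?case using insert by (simp add: divides_mult)
qed simp

lemma sum_ln_prime_divisors_le:
  assumes "finite P" "\<And>p. p \<in> P \<Longrightarrow> prime (p::nat) \<and> p dvd n" "n > 0"
  shows "(\<Sum>p\<in>P. ln (real p)) \<le> ln (real n)"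
proof -
  have "\<Prod>P dvd n" using assms by (intro prod_primes_dvd) auto
  then have le: "real (\<Prod>P) \<le> real n" using assms(3) by (simp only: of_nat_le_iff dvd_imp_le)
  have "0 < \<Prod>P" using assms by (intro prod_pos) (auto intro: prime_gt_0_nat)
  then have pos: "0 < real (\<Prod>P)" by (simp only: of_nat_0_less_iff)
  have "(\<Sum>p\<in>P. ln (real p)) = ln (real (\<Prod>P))"
    unfolding of_nat_prod using assms by (subst ln_prod) (auto dest: prime_gt_0_nat)
  also have "\<dots> \<le> ln (real n)" using le pos by (rule ln_mono)
  finally show ?thesis .
qed

text \<open>The primes in \<open>{m+2..2*m+1}\<close> all divide \<open>2*m+1 choose m\<close>, so the sum at \<open>2*m+1\<close> exceeds the sum at
  \<open>m+1\<close> by at most \<open>(2*m+1) * ln 2\<close>. The constant \<open>3\<close> leaves enough room for the induction to close.\<close>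
lemma theta_upper: "(\<Sum>p\<in>primes_upto n. ln (real p)) \<le> 3 * real n"
proof (induction n rule: less_induct)
  case (less n)
  consider "n < 2" | "n = 2" | "n > 2" "even n" | "n > 2" "odd n" by linarith
  then show ?case
  proof cases
    case 1
    then have "primes_upto n = {}" by (auto dest: primes_uptoD)
    then show ?thesis by simp
  next
    case 2
    have "primes_upto 2 = {2}" by (auto simp: primes_upto_def intro: antisym dest: prime_ge_2_nat)
    then show ?thesis using 2 ln_le_minus_one[of 2] by simp
  next
    case 3
    then obtain m where m: "n = Suc m" by (cases n) auto
    have "\<not> prime n" using 3 prime_odd_nat by auto
    then have "primes_upto n = primes_upto m" by (simp add: m primes_upto_Suc)
    then show ?thesis using less.IH[of m] m by simp
  next
    case 4
    then obtain m where m: "n = 2 * m + 1" by (auto elim: oddE)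
    then have m1: "m \<ge> 1" using 4 by simp
    define Q where "Q = primes_upto n - primes_upto (m + 1)"
    have Q: "finite Q" "\<And>p. p \<in> Q \<Longrightarrow> prime p \<and> m + 1 < p \<and> p \<le> 2 * m + 1"
      by (auto simp: Q_def primes_upto_def m)
    have "p dvd (2 * m + 1 choose m)" if "p \<in> Q" for p
    proof -
      have p: "prime p" "m + 1 < p" "p \<le> 2 * m + 1" using Q(2)[OF that] by auto
      have "p dvd fact (2 * m + 1)" using p by (simp add: prime_dvd_fact_iff del: fact_Suc)
      also have "fact (2 * m + 1) = fact m * fact (m + 1) * (2 * m + 1 choose m)"
        using binomial_fact_lemma[of m "2 * m + 1"] by (simp add: algebra_simps)
      finally show ?thesis
        using p by (simp add: prime_dvd_mult_iff prime_dvd_fact_iff del: fact_Suc)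
    qed
    then have "(\<Sum>p\<in>Q. ln (real p)) \<le> ln (real (2 * m + 1 choose m))"
      using Q by (intro sum_ln_prime_divisors_le) (auto simp: zero_less_binomial)
    also have "\<dots> \<le> ln (real (2 ^ (2 * m + 1)))"
    proof (rule ln_mono)
      show "real (2 * m + 1 choose m) \<le> real (2 ^ (2 * m + 1))"
        unfolding of_nat_le_iff by (rule binomial_le_pow2)
    qed (simp add: zero_less_binomial)
    also have "\<dots> = real (2 * m + 1) * ln 2"
      unfolding of_nat_power by (subst ln_realpow) auto
    also have "\<dots> \<le> real (2 * m + 1) * 1"
      using ln_le_minus_one[of 2] by (intro mult_left_mono) auto
    finally have q: "(\<Sum>p\<in>Q. ln (real p)) \<le> real (2 * m + 1)" by simp
    have "(\<Sum>p\<in>primes_upto n. ln (real p)) = (\<Sum>p\<in>primes_upto (m+1). ln (real p)) + (\<Sum>p\<in>Q. ln (real p))"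
      unfolding Q_def
      by (subst sum.subset_diff[OF primes_upto_mono[of "m + 1" n]]) (auto simp: m)
    also have "\<dots> \<le> 3 * real (m + 1) + real (2 * m + 1)"
      using less.IH[of "m+1"] m m1 q by (intro add_mono) auto
    also have "\<dots> \<le> 3 * real n" using m m1 by simp
    finally show ?thesis .
  qed
qed

lemma ln_fact_upper: "ln (fact n :: real) \<le> real n * ln (real n)"
proof (cases "n = 0")
  case False
  have "ln (fact n :: real) \<le> ln (real (n ^ n))"
    using False fact_le_power[of n, where 'a=real] by (subst ln_le_cancel_iff) auto
  then show ?thesis using False by (simp add: ln_realpow)
qed simp

lemma ln_fact_lower: "ln (fact n :: real) \<ge> real n * ln (real n) - real n"
proof (induction n)
  case (Suc n)
  show ?case
  proof (cases "n = 0")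
    case False
    have "ln (1 + 1 / real n) \<le> 1 / real n" by (rule ln_add_one_self_le_self) simp
    also have "1 + 1 / real n = (real n + 1) / real n" using False by (simp add: field_simps)
    finally have "real n * (ln (real n + 1) - ln (real n)) \<le> 1"
      using False by (simp add: ln_div field_simps)
    moreover have "ln (fact (Suc n) :: real) = ln (real n + 1) + ln (fact n)"
      by (simp add: ln_mult add.commute)
    ultimately show ?thesis using Suc by (simp add: algebra_simps)
  qed simp
qed simp

text \<open>Only the multiples of \<open>p\<close> contribute, and the multiplicity of \<open>p\<close> in \<open>p * j\<close> is one more than in \<open>j\<close>.
  Hence the sum \<open>S n\<close> satisfies \<open>S n = q + S q\<close> for \<open>q = n div p\<close>, which sums to a geometric series.\<close>
lemma sum_multiplicity_upto:
  assumes p: "prime p"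
  shows "real (\<Sum>m\<in>{1..n}. multiplicity p m) \<le> real n / (real p - 1)"
proof (induction n rule: less_induct)
  case (less n)
  have p2: "p \<ge> 2" using p by (rule prime_ge_2_nat)
  define q where "q = n div p"
  show ?case
  proof (cases "n = 0")
    case False
    have "(\<Sum>m\<in>{1..n}. multiplicity p m) = (\<Sum>m\<in>(\<lambda>j. p * j) ` {1..q}. multiplicity p m)"
    proof (rule sum.mono_neutral_right)
      show "(\<lambda>j. p * j) ` {1..q} \<subseteq> {1..n}"
        using p2 by (auto simp: q_def less_eq_div_iff_mult_less_eq mult.commute)
      show "\<forall>i\<in>{1..n} - (\<lambda>j. p * j) ` {1..q}. multiplicity p i = 0"
      proof
        fix i assume i: "i \<in> {1..n} - (\<lambda>j. p * j) ` {1..q}"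
        have "\<not> p dvd i"
        proof
          assume "p dvd i"
          then obtain j where j: "i = p * j" by auto
          then have "j \<in> {1..q}" using i p2
            by (auto simp: q_def less_eq_div_iff_mult_less_eq mult.commute Suc_le_eq)
          with i j show False by auto
        qed
        then show "multiplicity p i = 0" by (rule not_dvd_imp_multiplicity_0)
      qed
    qed simp
    also have "\<dots> = (\<Sum>j\<in>{1..q}. multiplicity p (p * j))"
      using p2 by (subst sum.reindex) (auto simp: inj_on_def)
    also have "\<dots> = (\<Sum>j\<in>{1..q}. Suc (multiplicity p j))"
      using p2 p by (intro sum.cong multiplicity_times_same refl) auto
    also have "\<dots> = q + (\<Sum>j\<in>{1..q}. multiplicity p j)"
      by (simp only: Suc_eq_plus1 sum.distrib) simp
    finally have "real (\<Sum>m\<in>{1..n}. multiplicity p m) = q + real (\<Sum>j\<in>{1..q}. multiplicity p j)"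
      by (metis of_nat_add)
    also have "\<dots> \<le> q + q / (real p - 1)"
      using less.IH[of q] False p2 by (intro add_left_mono) (simp add: q_def)
    also have "\<dots> = real q * real p / (real p - 1)" using p2 by (simp add: field_simps)
    also have "\<dots> \<le> n / (real p - 1)"
    proof (rule divide_right_mono)
      have "q * p \<le> n" unfolding q_def by (rule div_times_less_eq_dividend)
      then show "real q * real p \<le> real n" by (metis of_nat_le_iff of_nat_mult)
    qed (use p2 in auto)
    finally show ?thesis .
  qed simp
qed

text \<open>Legendre's formula in logarithmic form. The two bounds of Mertens' first theorem follow by estimating
  the inner sum: from below by \<open>n / p - 1\<close> (the multiples of \<open>p\<close>), from above by \<open>n / (p - 1)\<close>.\<close>
lemma ln_fact_eq_sum_primes:
  "ln (fact n :: real) = (\<Sum>p\<in>primes_upto n. real (\<Sum>m\<in>{1..n}. multiplicity p m) * ln (real p))"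
proof -
  have fact: "(fact n :: nat) = (\<Prod>p\<in>primes_upto n. p ^ multiplicity p (fact n :: nat))"
  proof -
    have "prime_factors (fact n :: nat) = primes_upto n"
      by (auto simp: prime_factors_dvd primes_upto_def prime_dvd_fact_iff)
    then show ?thesis using prime_factorization_nat[of "fact n"] by (metis fact_gt_zero)
  qed
  have mult: "multiplicity p (fact n :: nat) = (\<Sum>m\<in>{1..n}. multiplicity p m)" if "prime p" for p
    unfolding fact_prod of_nat_id
    by (subst prime_elem_multiplicity_prod_distrib) (use that in auto)
  have "ln (fact n :: real) = ln (real (fact n))" by simp
  also have "\<dots> = ln (\<Prod>p\<in>primes_upto n. real p ^ multiplicity p (fact n :: nat))"
    by (subst fact) (simp only: of_nat_prod of_nat_power)
  also have "\<dots> = (\<Sum>p\<in>primes_upto n. ln (real p ^ multiplicity p (fact n :: nat)))"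
    by (subst ln_prod) (auto dest: primes_uptoD)
  also have "\<dots> = (\<Sum>p\<in>primes_upto n. real (\<Sum>m\<in>{1..n}. multiplicity p m) * ln (real p))"
    by (intro sum.cong refl) (auto dest!: primes_uptoD simp: ln_realpow mult)
  finally show ?thesis .
qed

lemma mertens_first_upper:
  assumes "n \<ge> 1"
  shows "(\<Sum>p\<in>primes_upto n. ln (real p) / real p) \<le> ln (real n) + 3"
proof -
  have "real n * (\<Sum>p\<in>primes_upto n. ln (real p) / real p) - (\<Sum>p\<in>primes_upto n. ln (real p))
      = (\<Sum>p\<in>primes_upto n. (real n / real p - 1) * ln (real p))"
    by (simp add: sum_distrib_left sum_subtractf[symmetric] algebra_simps)
  also have "\<dots> \<le> (\<Sum>p\<in>primes_upto n. real (\<Sum>m\<in>{1..n}. multiplicity p m) * ln (real p))"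
  proof (intro sum_mono mult_right_mono)
    fix p assume "p \<in> primes_upto n"
    then have p: "prime p" "p \<ge> 2" "p \<le> n" by (auto dest: primes_uptoD)
    then show "0 \<le> ln (real p)" by simp
    have "real n / real p \<le> real (n div p) + 1"
      using floor_divide_of_nat_eq[of n p, where 'a=real] floor_correct[of "real n / real p"]
      by linarith
    moreover have "n div p \<le> (\<Sum>m\<in>{1..n}. multiplicity p m)"
    proof -
      have "n div p = (\<Sum>m\<in>(\<lambda>j. p * j) ` {1..n div p}. 1)"
        using p by (simp add: card_image inj_on_def)
      also have "\<dots> \<le> (\<Sum>m\<in>(\<lambda>j. p * j) ` {1..n div p}. multiplicity p m)"
        using p by (intro sum_mono) (auto simp: Suc_le_eq multiplicity_gt_zero_iff)
      also have "\<dots> \<le> (\<Sum>m\<in>{1..n}. multiplicity p m)"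
        using p by (intro sum_mono2) (auto simp: less_eq_div_iff_mult_less_eq mult.commute)
      finally show ?thesis .
    qed
    ultimately show "real n / real p - 1 \<le> real (\<Sum>m\<in>{1..n}. multiplicity p m)"
      by (smt (verit) of_nat_le_iff)
  qed
  also have "\<dots> = ln (fact n)" by (rule ln_fact_eq_sum_primes[symmetric])
  also have "\<dots> \<le> real n * ln (real n)" by (rule ln_fact_upper)
  finally have "real n * (\<Sum>p\<in>primes_upto n. ln (real p) / real p) \<le> real n * (ln (real n) + 3)"
    using theta_upper[of n] by (simp add: algebra_simps)
  then show ?thesis using assms by simp
qed

text \<open>The right-hand side is the telescoped form: \<open>(ln x + 2) / x\<close> drops by at least the summand in each
  step, as \<open>ln (1 + 1 / x) \<le> 1 / x\<close>. The sum bounds the contribution of higher prime powers to \<open>ln n!\<close>.\<close>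
lemma sum_ln_over_square:
  assumes "n \<ge> 1"
  shows "(\<Sum>j\<in>{2..n}. ln (real j) / (real j * (real j - 1))) \<le> 2 - (ln (real n) + 2) / real n"
  using assms
proof (induction n rule: dec_induct)
  case (step n)
  have n: "n \<ge> 1" using step by simp
  have "ln (1 + 1 / real n) \<le> 1 / real n" by (rule ln_add_one_self_le_self) simp
  also have "1 + 1 / real n = (real n + 1) / real n" using n by (simp add: field_simps)
  finally have "ln (real n + 1) - ln (real n) \<le> 1 / real n" using n by (simp add: ln_div)
  then have "(real n + 1) * (ln (real n + 1) - ln (real n)) \<le> (real n + 1) * (1 / real n)"
    by (intro mult_left_mono) auto
  also have "\<dots> \<le> 2" using n by (simp add: field_simps)
  finally have *: "(real n + 1) * ln (real n + 1) \<le> 2 + (real n + 1) * ln (real n)"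
    by (simp add: algebra_simps)
  have "ln (real n + 1) / ((real n + 1) * real n)
      \<le> ((real n + 1) * (ln (real n) + 2) - real n * (ln (real n + 1) + 2)) / ((real n + 1) * real n)"
    using * n by (intro divide_right_mono) (auto simp: algebra_simps)
  also have "\<dots> = (ln (real n) + 2) / real n - (ln (real n + 1) + 2) / (real n + 1)"
    using n by (simp add: diff_divide_distrib)
  finally show ?case using step.IH n by (simp add: add.commute)
qed simp

lemma mertens_first_lower:
  assumes "n \<ge> 1"
  shows "(\<Sum>p\<in>primes_upto n. ln (real p) / real p) \<ge> ln (real n) - 3"
proof -
  have "real n * ln (real n) - real n \<le> ln (fact n)" by (rule ln_fact_lower)
  also have "\<dots> = (\<Sum>p\<in>primes_upto n. real (\<Sum>m\<in>{1..n}. multiplicity p m) * ln (real p))"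
    by (rule ln_fact_eq_sum_primes)
  also have "\<dots> \<le> (\<Sum>p\<in>primes_upto n. real n / (real p - 1) * ln (real p))"
    by (intro sum_mono mult_right_mono sum_multiplicity_upto) (auto dest: primes_uptoD)
  also have "\<dots> = (\<Sum>p\<in>primes_upto n. real n * (ln (real p) / real p)
                     + real n * (ln (real p) / (real p * (real p - 1))))"
  proof (intro sum.cong refl)
    fix p assume "p \<in> primes_upto n"
    then have "p \<ge> 2" by (auto dest: primes_uptoD)
    then show "real n / (real p - 1) * ln (real p) =
       real n * (ln (real p) / real p) + real n * (ln (real p) / (real p * (real p - 1)))"
      by (simp add: divide_simps) (simp add: algebra_simps)
  qed
  also have "\<dots> = real n * (\<Sum>p\<in>primes_upto n. ln (real p) / real p)
       + real n * (\<Sum>p\<in>primes_upto n. ln (real p) / (real p * (real p - 1)))"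
    by (simp add: sum.distrib sum_distrib_left)
  finally have main: "real n * ln (real n) - real n \<le> \<dots>" .
  have "(\<Sum>p\<in>primes_upto n. ln (real p) / (real p * (real p - 1)))
      \<le> (\<Sum>j\<in>{2..n}. ln (real j) / (real j * (real j - 1)))"
    by (rule sum_mono2) (auto dest: primes_uptoD)
  also have "\<dots> \<le> 2 - (ln (real n) + 2) / real n" by (rule sum_ln_over_square) fact
  also have "\<dots> \<le> 2" using assms by simp
  finally have "real n * (\<Sum>p\<in>primes_upto n. ln (real p) / (real p * (real p - 1))) \<le> real n * 2"
    by (intro mult_left_mono) auto
  with main have "real n * (ln (real n) - 3) \<le> real n * (\<Sum>p\<in>primes_upto n. ln (real p) / real p)"
    by (simp add: algebra_simps)
  then show ?thesis using assms by simp
qed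

text \<open>Both bounds of Mertens' first theorem have an error of at most \<open>3\<close>, so the sum of \<open>ln p / p\<close> over
  \<open>K < p \<le> N\<close> is at least \<open>ln (N / K) - 6\<close>. The ratio \<open>3 ^ 7 \<ge> exp 7\<close> makes this at least \<open>1\<close>, and each
  \<open>ln p\<close> in the range is at least \<open>K\<close> times \<open>ln p / p\<close>.\<close>
lemma theta_interval_lower:
  assumes K: "K = N div 3 ^ 7" "K \<ge> 1"
  shows "(\<Sum>p\<in>primes_upto N - primes_upto K. ln (real p)) \<ge> real K"
proof -
  let ?f = "\<lambda>p. ln (real p) / real p"
  have KN: "K * 3 ^ 7 \<le> N" unfolding K(1) by (rule div_times_less_eq_dividend)
  have "ln (real K) + 7 \<le> ln (real K) + ln (3 ^ 7)"
  proof -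
    have "1 \<le> ln (3::real)" using exp_le by (subst ln_ge_iff) auto
    then show ?thesis by (subst ln_realpow) auto
  qed
  also have "\<dots> = ln (real (K * 3 ^ 7))"
    using K(2) by (simp only: of_nat_mult of_nat_power of_nat_numeral) (subst ln_mult, auto)
  also have "\<dots> \<le> ln (real N)"
  proof (rule ln_mono)
    show "real (K * 3 ^ 7) \<le> real N" using KN by (simp only: of_nat_le_iff)
  qed (use K(2) in simp)
  finally have "1 \<le> (ln (real N) - 3) - (ln (real K) + 3)" by simp
  also have "\<dots> \<le> (\<Sum>p\<in>primes_upto N. ?f p) - (\<Sum>p\<in>primes_upto K. ?f p)"
    using K(2) KN by (intro diff_mono mertens_first_lower mertens_first_upper) auto
  also have "\<dots> = (\<Sum>p\<in>primes_upto N - primes_upto K. ?f p)"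
    using KN by (intro sum_diff[symmetric] primes_upto_mono) auto
  finally have "real K * 1 \<le> real K * (\<Sum>p\<in>primes_upto N - primes_upto K. ?f p)"
    by (intro mult_left_mono) auto
  also have "\<dots> \<le> (\<Sum>p\<in>primes_upto N - primes_upto K. ln (real p))"
    unfolding sum_distrib_left
  proof (rule sum_mono)
    fix p assume "p \<in> primes_upto N - primes_upto K"
    then have "p \<ge> 2" "K \<le> p" by (auto simp: primes_upto_def prime_ge_2_nat)
    then have "real K * ln p \<le> p * ln p" by (intro mult_right_mono) auto
    then show "real K * (ln (real p) / real p) \<le> ln (real p)" using \<open>p \<ge> 2\<close> by (simp add: field_simps)
  qed
  finally show ?thesis by simp
qed

text \<open>Partial summation of \<open>1 / p = (ln p / p) * (1 / ln p)\<close> from Mertens' first theorem, in the form of an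
  induction: writing \<open>A\<close> and \<open>B\<close> for the sums of \<open>ln p / p\<close> and \<open>1 / p\<close>, the quantity \<open>B n - A n / ln n\<close>
  changes from \<open>n\<close> to \<open>n + 1\<close> by \<open>A n * (1 / ln n - 1 / ln (n + 1))\<close>, whether or not \<open>n + 1\<close> is prime. The bound
  \<open>1 - u / v \<le> ln v - ln u\<close> turns the main term into a difference of values of \<open>ln (ln n)\<close>.\<close>
lemma sum_inverse_primes_upper:
  assumes "n \<ge> 2"
  shows "(\<Sum>p\<in>primes_upto n. 1 / real p) \<le> ln (ln (real n)) + (1 + 3 / ln 2 - ln (ln 2))"
proof -
  define A where "A = (\<lambda>n. \<Sum>p\<in>primes_upto n. ln (real p) / real p)"
  define B where "B = (\<lambda>n. \<Sum>p\<in>primes_upto n. 1 / real p)"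
  have A: "A n \<le> ln (real n) + 3" if "n \<ge> 2" for n
    unfolding A_def using that by (intro mertens_first_upper) auto
  have "B n - A n / ln (real n) \<le> ln (ln (real n)) - 3 / ln (real n) + (3 / ln 2 - ln (ln 2))"
    using assms
  proof (induction n rule: dec_induct)
    case base
    have "primes_upto 2 = {2}" by (auto simp: primes_upto_def intro: antisym dest: prime_ge_2_nat)
    then show ?case by (simp add: A_def B_def)
  next
    case (step n)
    define a b where "a = ln (real n)" and "b = ln (real (Suc n))"
    have ab: "0 < a" "a \<le> b" using step by (auto simp: a_def b_def)
    have "B (Suc n) - A (Suc n) / b = B n - A n / b"
    proof (cases "prime (Suc n)")
      case True
      have "Suc n \<notin> primes_upto n" by (simp add: primes_upto_def)
      then have "A (Suc n) = b / real (Suc n) + A n" "B (Suc n) = 1 / real (Suc n) + B n"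
        using True by (simp_all add: A_def B_def primes_upto_Suc b_def)
      then show ?thesis using ab by (simp add: add_divide_distrib)
    qed (simp add: A_def B_def primes_upto_Suc)
    also have "\<dots> = (B n - A n / a) + A n * (1 / a - 1 / b)" by (simp add: algebra_simps)
    also have "A n * (1 / a - 1 / b) \<le> (a + 3) * (1 / a - 1 / b)"
      using A[of n] step ab by (intro mult_right_mono) (auto simp: a_def[symmetric] frac_le)
    also have "\<dots> = (1 - a / b) + 3 / a - 3 / b" using ab by (simp add: field_simps)
    also have "1 - a / b \<le> ln b - ln a"
      using ln_le_minus_one[of "a / b"] ab by (simp add: ln_div)
    finally show ?case using step.IH by (simp add: a_def[symmetric] b_def[symmetric] del: of_nat_Suc)
  qed
  moreover have "A n / ln (real n) \<le> 1 + 3 / ln (real n)"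
    using divide_right_mono[OF A[OF assms], of "ln (real n)"] assms by (simp add: add_divide_distrib)
  ultimately show ?thesis by (simp add: B_def)
qed

text \<open>As \<open>1 - 1 / p \<ge> exp (- 1 / (p - 1))\<close>, and \<open>1 / (p - 1)\<close> differs from \<open>1 / p\<close> by the summable
  \<open>1 / (p * (p - 1))\<close>, the bound on the sum of \<open>1 / p\<close> can be exponentiated.\<close>
lemma mertens_product_lower:
  obtains c :: real where "c > 0"
    "\<And>k. k \<ge> 2 \<Longrightarrow> c / ln (real k) \<le> (\<Prod>p\<in>primes_upto k. 1 - 1 / real p)"
proof
  define D :: real where "D = 1 + 3 / ln 2 - ln (ln 2)"
  show "exp (- (D + 1)) > 0" by simp
  fix k :: nat assume k: "k \<ge> 2"
  have tele: "(\<Sum>j\<in>{2..n}. 1 / (real j * (real j - 1))) \<le> 1 - 1 / real n" if "n \<ge> 1" for n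
    using that
  proof (induction n rule: dec_induct)
    case (step n)
    have "1 / ((real n + 1) * real n) = 1 / real n - 1 / (real n + 1)"
      using step by (simp add: field_simps)
    then show ?case using step by (simp add: add.commute)
  qed simp
  have "(\<Sum>p\<in>primes_upto k. 1 / (real p - 1))
      = (\<Sum>p\<in>primes_upto k. 1 / real p + 1 / (real p * (real p - 1)))"
    by (intro sum.cong refl) (auto dest!: primes_uptoD simp: divide_simps)
  also have "\<dots> = (\<Sum>p\<in>primes_upto k. 1 / real p) + (\<Sum>p\<in>primes_upto k. 1 / (real p * (real p - 1)))"
    by (rule sum.distrib)
  also have "\<dots> \<le> (ln (ln (real k)) + D) + (\<Sum>j\<in>{2..k}. 1 / (real j * (real j - 1)))"
    using sum_inverse_primes_upper[OF k] unfolding D_def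
    by (intro add_mono sum_mono2) (auto dest: primes_uptoD)
  also have "\<dots> \<le> ln (ln (real k)) + D + (1 - 1 / real k)" using tele[of k] k by simp
  also have "\<dots> \<le> ln (ln (real k)) + (D + 1)" using k by simp
  finally have le: "(\<Sum>p\<in>primes_upto k. 1 / (real p - 1)) \<le> ln (ln (real k)) + (D + 1)" .
  have "exp (- (D + 1)) / ln (real k) = exp (- (ln (ln (real k)) + (D + 1)))"
    using k by (simp only: minus_add_distrib exp_add) (simp add: exp_minus field_simps)
  also have "\<dots> \<le> exp (- (\<Sum>p\<in>primes_upto k. 1 / (real p - 1)))" using le by simp
  also have "\<dots> = (\<Prod>p\<in>primes_upto k. exp (- (1 / (real p - 1))))"
    by (simp add: exp_sum[symmetric] sum_negf)
  also have "\<dots> \<le> (\<Prod>p\<in>primes_upto k. 1 - 1 / real p)"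
  proof (rule prod_mono, intro conjI)
    fix p assume "p \<in> primes_upto k"
    then have p: "real p \<ge> 2" by (auto dest: primes_uptoD)
    have "real p / (real p - 1) = 1 + 1 / (real p - 1)" using p by (simp add: field_simps)
    also have "\<dots> \<le> exp (1 / (real p - 1))" by (rule exp_ge_add_one_self)
    finally have "1 / exp (1 / (real p - 1)) \<le> 1 / (real p / (real p - 1))"
      using p by (intro divide_left_mono) auto
    then show "exp (- (1 / (real p - 1))) \<le> 1 - 1 / real p"
      using p by (simp add: exp_minus field_simps)
  qed simp
  finally show "exp (- (D + 1)) / ln (real k) \<le> (\<Prod>p\<in>primes_upto k. 1 - 1 / real p)" .
qed

section \<open>Integers without small prime factors\<close>

definition sifted :: "nat set \<Rightarrow> nat \<Rightarrow> nat set" where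
  "sifted P x = {m \<in> {1..x}. \<forall>p\<in>P. \<not> p dvd m}"

lemma finite_sifted [simp, intro]: "finite (sifted P x)"
  by (simp add: sifted_def)

text \<open>Adding \<open>p\<close> to \<open>P\<close> removes the multiples \<open>p * j\<close> from the sum. Each such \<open>j\<close> itself survives the
  sifting by \<open>P\<close>, so what is lost is at most \<open>1 / p\<close> of the previous sum.\<close>
lemma sifted_harmonic_lower:
  assumes "finite P" "0 \<notin> P"
  shows "(\<Prod>p\<in>P. 1 - 1 / real p) * harm x \<le> (\<Sum>m\<in>sifted P x. 1 / real m)"
  using assms
proof (induction P)
  case empty
  have "sifted {} x = {1..x}" by (auto simp: sifted_def)
  then show ?case by (simp add: harm_def inverse_eq_divide)
next
  case (insert p P)
  let ?R = "\<lambda>P. \<Sum>m\<in>sifted P x. 1 / real m"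
  have p: "p \<ge> 1" using insert by (auto simp: Suc_le_eq intro: gr0I)
  define M where "M = {m \<in> sifted P x. p dvd m}"
  have "sifted P x = sifted (insert p P) x \<union> M" "sifted (insert p P) x \<inter> M = {}"
    by (auto simp: sifted_def M_def)
  moreover have "finite M" by (simp add: M_def)
  ultimately have "?R P = ?R (insert p P) + (\<Sum>m\<in>M. 1 / real m)"
    by (simp add: sum.union_disjoint)
  also have "(\<Sum>m\<in>M. 1 / real m) \<le> (\<Sum>m\<in>(\<lambda>j. p * j) ` sifted P x. 1 / real m)"
  proof (rule sum_mono2)
    show "M \<subseteq> (\<lambda>j. p * j) ` sifted P x"
    proof
      fix m assume m: "m \<in> M"
      then obtain j where j: "m = p * j" by (auto simp: M_def)
      have "j \<in> sifted P x"
        using m p unfolding M_def sifted_def j by (auto simp: Suc_le_eq intro: le_trans[rotated])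
      then show "m \<in> (\<lambda>j. p * j) ` sifted P x" using j by auto
    qed
  qed auto
  also have "\<dots> = (\<Sum>j\<in>sifted P x. 1 / real (p * j))"
    using p by (subst sum.reindex) (auto simp: inj_on_def)
  also have "\<dots> = 1 / real p * ?R P" by (simp add: sum_distrib_left)
  finally have "(1 - 1 / real p) * ?R P \<le> ?R (insert p P)" by (simp add: algebra_simps)
  moreover have "(1 - 1 / real p) * ((\<Prod>p\<in>P. 1 - 1 / real p) * harm x) \<le> (1 - 1 / real p) * ?R P"
    using insert p by (intro mult_left_mono) auto
  ultimately show ?case using insert by (simp add: mult.assoc)
qed

lemma div_ge_half:
  assumes "0 < b" "b \<le> (a::nat)"
  shows "real a / (2 * real b) \<le> real (a div b)"
proof -
  have "a < b * Suc (a div b)" using dividend_less_times_div[OF assms(1), of a] by simp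
  also have "\<dots> \<le> b * (2 * (a div b))"
    using assms div_greater_zero_iff[of a b] by (intro mult_left_mono) (auto simp: Suc_le_eq)
  finally have "real a \<le> real (b * (2 * (a div b)))" by (simp only: of_nat_le_iff less_imp_le)
  then show ?thesis using assms by (simp add: field_simps)
qed

text \<open>Writing \<open>d = m * p\<close> with a prime \<open>p > k\<close>, the pairs \<open>(m, p)\<close> with \<open>m * p \<le> x\<close> inject into the pairs of a
  sifted \<open>d \<le> x\<close> and one of its prime factors, and the logarithms of the latter add up to at most
  \<open>ln d \<le> ln x\<close>. The restriction \<open>m \<le> Y\<close> ensures that \<open>x / m\<close> is at least \<open>3 ^ 7 * k\<close>, so that the
  Chebyshev estimate provides primes beyond \<open>k\<close>.\<close>
lemma sifted_primes_log_sum_lower: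
  assumes k: "k \<ge> 1" and Y: "Y = x div (3 ^ 7 * k)"
  shows "real x / (2 * 3 ^ 7) * (\<Sum>m\<in>sifted (primes_upto k) Y. 1 / real m)
           \<le> real (card (sifted (primes_upto k) x)) * ln (real x)"
proof -
  let ?F = "sifted (primes_upto k)"
  define Q where "Q = (\<lambda>m. primes_upto (x div m) - primes_upto k)"
  have "real x / (2 * 3 ^ 7) * (\<Sum>m\<in>?F Y. 1 / real m) = (\<Sum>m\<in>?F Y. real x / (2 * real (m * 3 ^ 7)))"
    by (simp add: sum_distrib_left field_simps)
  also have "\<dots> \<le> (\<Sum>m\<in>?F Y. \<Sum>p\<in>Q m. ln (real p))"
  proof (rule sum_mono)
    fix m assume "m \<in> ?F Y"
    then have m: "m \<ge> 1" "m \<le> x div (3 ^ 7 * k)" by (auto simp: sifted_def Y)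
    have mx: "m * 3 ^ 7 * k \<le> x"
    proof -
      have "m * (3 ^ 7 * k) \<le> x div (3 ^ 7 * k) * (3 ^ 7 * k)" using m by (intro mult_right_mono) auto
      also have "\<dots> \<le> x" by (rule div_times_less_eq_dividend)
      finally show ?thesis by (simp only: mult.assoc)
    qed
    define K where "K = x div m div 3 ^ 7"
    have K: "K = x div (m * 3 ^ 7)" by (simp only: K_def div_mult2_eq)
    have kK: "k \<le> K"
      unfolding K using mx m(1) by (subst less_eq_div_iff_mult_less_eq) (auto simp only: ac_simps, auto)
    have "m * 3 ^ 7 * 1 \<le> m * 3 ^ 7 * k" using k by (intro mult_left_mono) auto
    then have "real x / (2 * real (m * 3 ^ 7)) \<le> real K"
      unfolding K using mx m(1) by (intro div_ge_half) (simp, linarith)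
    also have "\<dots> \<le> (\<Sum>p\<in>primes_upto (x div m) - primes_upto K. ln (real p))"
      using kK k by (intro theta_interval_lower K_def) auto
    also have "\<dots> \<le> (\<Sum>p\<in>Q m. ln (real p))"
      unfolding Q_def using primes_upto_mono[OF kK] by (intro sum_mono2) (auto dest: primes_uptoD)
    finally show "real x / (2 * real (m * 3 ^ 7)) \<le> (\<Sum>p\<in>Q m. ln (real p))" .
  qed
  also have "\<dots> = (\<Sum>(m, p)\<in>Sigma (?F Y) Q. ln (real p))"
    by (rule sum.Sigma) (auto simp: Q_def)
  also have "\<dots> = (\<Sum>(d, p)\<in>(\<lambda>(m, p). (m * p, p)) ` Sigma (?F Y) Q. ln (real p))"
    by (subst sum.reindex) (auto simp: inj_on_def Q_def case_prod_unfold dest: primes_uptoD)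
  also have "\<dots> \<le> (\<Sum>(d, p)\<in>Sigma (?F x) prime_factors. ln (real p))"
  proof (rule sum_mono2)
    show "(\<lambda>(m, p). (m * p, p)) ` Sigma (?F Y) Q \<subseteq> Sigma (?F x) prime_factors"
    proof (clarify, intro conjI)
      fix m p assume m: "m \<in> ?F Y" and "p \<in> Q m"
      then have p: "prime p" "p \<le> x div m" "p > k" by (auto simp: Q_def primes_upto_def)
      have m1: "m \<ge> 1" using m by (auto simp: sifted_def)
      have "m * p \<le> x" using p(2) m1 by (simp add: less_eq_div_iff_mult_less_eq mult.commute)
      moreover have "\<not> q dvd m * p" if "q \<in> primes_upto k" for q
      proof
        assume "q dvd m * p"
        moreover have q: "prime q" "q \<le> k" using that by (auto simp: primes_upto_def)
        ultimately have "q dvd m \<or> q dvd p" by (simp add: prime_dvd_mult_iff)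
        then show False
        proof
          assume "q dvd m"
          then show False using m that by (auto simp: sifted_def)
        next
          assume "q dvd p"
          then have "q = p" using p(1) q(1) by (intro primes_dvd_imp_eq)
          then show False using p(3) q(2) by simp
        qed
      qed
      ultimately show "m * p \<in> ?F x" using m1 prime_gt_0_nat[OF p(1)] by (auto simp: sifted_def Suc_le_eq)
      show "p \<in> prime_factors (m * p)" using m1 p(1) by (auto simp: prime_factors_dvd)
    qed
  qed (auto dest!: in_prime_factors_imp_prime prime_ge_1_nat)
  also have "\<dots> = (\<Sum>d\<in>?F x. \<Sum>p\<in>prime_factors d. ln (real p))"
    by (rule sum.Sigma[symmetric]) auto
  also have "\<dots> \<le> (\<Sum>d\<in>?F x. ln (real x))"
  proof (rule sum_mono)
    fix d assume "d \<in> ?F x"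
    then have d: "0 < d" "d \<le> x" by (auto simp: sifted_def)
    then have "(\<Sum>p\<in>prime_factors d. ln (real p)) \<le> ln (real d)"
      by (intro sum_ln_prime_divisors_le) auto
    also have "\<dots> \<le> ln (real x)" using d by simp
    finally show "(\<Sum>p\<in>prime_factors d. ln (real p)) \<le> ln (real x)" .
  qed
  finally show ?thesis by simp
qed

text \<open>After division by \<open>ln x\<close>, the previous bound shows that it is enough for the sum \<open>R\<close> of reciprocals to be
  of order \<open>ln x / ln k\<close>. With \<open>z = 3 ^ 7 * k\<close>, this follows for \<open>x \<ge> z\<^sup>2\<close> from the harmonic bound, as \<open>x / z\<close>
  is at least the square root of \<open>x\<close>. For smaller \<open>x\<close> the ratio \<open>ln x / ln k\<close> is bounded, and the
  single term \<open>m = 1\<close> suffices; this case amounts to counting primes only.\<close>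
lemma card_sifted_primes_lower:
  obtains c :: real where "c > 0"
    "\<And>k x. k \<ge> 2 \<Longrightarrow> x \<ge> 3 ^ 7 * k \<Longrightarrow>
       c * real x / ln (real k) \<le> real (card (sifted (primes_upto k) x))"
proof -
  obtain c1 where c1: "c1 > 0"
    "\<And>k. k \<ge> 2 \<Longrightarrow> c1 / ln (real k) \<le> (\<Prod>p\<in>primes_upto k. 1 - 1 / real p)"
    using mertens_product_lower by blast
  define L where "L = 2 * (ln (3 ^ 7) / ln 2 + (1::real))"
  have ln2: "0 < ln (2::real)" by simp
  have L: "L > 0" by (auto simp: L_def intro!: add_nonneg_pos)
  define b where "b = min (c1 / 2) (1 / L)"
  define c where "c = b / (2 * 3 ^ 7)"
  have "c > 0" using c1(1) L by (simp add: c_def b_def)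
  moreover have "c * real x / ln (real k) \<le> real (card (sifted (primes_upto k) x))"
    if k: "k \<ge> 2" and x: "x \<ge> 3 ^ 7 * k" for k x
  proof -
    define Y where "Y = x div (3 ^ 7 * k)"
    define R where "R = (\<Sum>m\<in>sifted (primes_upto k) Y. 1 / real m)"
    define z where "z = real (3 ^ 7 * k)"
    have lnk: "0 < ln (real k)" using k by simp
    have x1: "real x > 1" using k x by auto
    have zx: "z \<le> real x" unfolding z_def using x by (simp only: of_nat_le_iff)
    have z: "z > 1" using k by (auto simp: z_def)
    have Y1: "Y \<ge> 1"
      unfolding Y_def using x k by (subst less_eq_div_iff_mult_less_eq) auto
    have "b * ln (real x) / ln (real k) \<le> R"
    proof (cases "real x \<ge> z\<^sup>2")
      case True
      have "x < 3 ^ 7 * k * Suc Y" unfolding Y_def using k dividend_less_times_div[of "3 ^ 7 * k" x] by simp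
      then have "real x < z * (real Y + 1)"
        unfolding z_def by (metis of_nat_Suc of_nat_less_iff of_nat_mult add.commute)
      then have "real x ^ 2 \<le> (z * (real Y + 1)) ^ 2" by (intro power_mono) auto
      also have "\<dots> = z\<^sup>2 * (real Y + 1)\<^sup>2" by (rule power_mult_distrib)
      also have "\<dots> \<le> real x * (real Y + 1)\<^sup>2" using True by (intro mult_right_mono) auto
      finally have "real x \<le> (real Y + 1)\<^sup>2" using x1 by (simp add: power2_eq_square)
      then have "ln (real x) \<le> ln ((real Y + 1)\<^sup>2)" using x1 by (intro ln_mono) auto
      also have "\<dots> = 2 * ln (real Y + 1)" by (subst ln_realpow) auto
      finally have lnx: "ln (real x) / 2 \<le> ln (real Y + 1)" by simp
      have "b * ln (real x) / ln (real k) \<le> (c1 / 2) * ln (real x) / ln (real k)"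
        using x1 lnk by (intro divide_right_mono mult_right_mono) (auto simp: b_def)
      also have "\<dots> = (c1 / ln (real k)) * (ln (real x) / 2)" by simp
      also have "\<dots> \<le> (\<Prod>p\<in>primes_upto k. 1 - 1 / real p) * harm Y"
      proof (rule mult_mono)
        show "ln (real x) / 2 \<le> harm Y" using lnx ln_le_harm[of Y] by (simp add: add.commute)
        show c: "c1 / ln (real k) \<le> (\<Prod>p\<in>primes_upto k. 1 - 1 / real p)" by (rule c1) fact
        have "0 \<le> c1 / ln (real k)" using c1 lnk by simp
        with c show "0 \<le> (\<Prod>p\<in>primes_upto k. 1 - 1 / real p)" by linarith
      qed (use x1 in auto)
      also have "\<dots> \<le> R" unfolding R_def by (intro sifted_harmonic_lower) (auto dest: primes_uptoD)
      finally show ?thesis .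
    next
      case False
      have "ln (real x) \<le> ln (z\<^sup>2)" using False x1 by (intro ln_mono) auto
      also have "\<dots> = 2 * (ln (3 ^ 7) + ln (real k))"
        using z k by (subst ln_realpow) (auto simp: z_def ln_mult)
      also have "\<dots> \<le> L * ln (real k)"
      proof -
        have "ln (3 ^ 7 :: real) * ln 2 \<le> ln (3 ^ 7) * ln (real k)" using k by (intro mult_left_mono) auto
        then have "ln (3 ^ 7 :: real) \<le> ln (3 ^ 7) / ln 2 * ln (real k)" using ln2 by (simp add: field_simps)
        then show ?thesis by (simp add: L_def algebra_simps)
      qed
      finally have lnx: "ln (real x) \<le> L * ln (real k)" .
      have "b * ln (real x) / ln (real k) \<le> (1 / L) * (L * ln (real k)) / ln (real k)"
        using lnx L lnk x1 c1(1) by (intro divide_right_mono mult_mono) (auto simp: b_def)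
      also have "\<dots> = 1" using L lnk by simp
      also have "1 = (\<Sum>m\<in>{1::nat}. 1 / real m)" by simp
      also have "\<dots> \<le> R" unfolding R_def
        using Y1 by (intro sum_mono2) (auto simp: sifted_def dest: primes_uptoD)
      finally show ?thesis .
    qed
    then have "real x / (2 * 3 ^ 7) * (b * ln (real x) / ln (real k)) \<le> real x / (2 * 3 ^ 7) * R"
      by (intro mult_left_mono) auto
    also have "\<dots> \<le> real (card (sifted (primes_upto k) x)) * ln (real x)"
      unfolding R_def using k by (intro sifted_primes_log_sum_lower) (auto simp: Y_def)
    finally have "(c * real x / ln (real k)) * ln (real x) \<le> real (card (sifted (primes_upto k) x)) * ln (real x)"
      by (simp add: c_def mult_ac)
    then show ?thesis by (rule mult_right_le_imp_le) (use x1 in simp)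
  qed
  ultimately show ?thesis using that by blast
qed

section \<open>Progressions with sifted differences\<close>

lemma coprime_sifted_small:
  assumes "d \<in> sifted (primes_upto k) x" "1 \<le> s" "s \<le> k"
  shows "coprime d s"
proof (rule ccontr)
  assume "\<not> coprime d s"
  then have "gcd d s \<noteq> 1" by (simp add: coprime_iff_gcd_eq_1)
  then obtain q where q: "prime q" "q dvd gcd d s" using prime_factor_nat by blast
  then have "q dvd s" "q dvd d" by auto
  then have "q \<le> k" using assms by (auto dest!: dvd_imp_le)
  then show False using assms(1) q(1) \<open>q dvd d\<close> by (auto simp: sifted_def primes_upto_def)
qed

text \<open>This uniqueness is the reason for sifting: the distance of two points determines the difference of any
  admissible progression that contains both.\<close>
lemma sifted_factor_unique:
  assumes "d \<in> sifted (primes_upto k) x" "1 \<le> s" "s \<le> k"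
    and "d' \<in> sifted (primes_upto k) x" "1 \<le> s'" "s' \<le> k"
    and eq: "s * d = s' * d'"
  shows "d = d'"
proof (rule dvd_antisym)
  have "d dvd s' * d'" unfolding eq[symmetric] by simp
  then show "d dvd d'"
    using coprime_sifted_small[OF assms(1,5,6)] by (simp add: coprime_dvd_mult_right_iff)
  have "d' dvd s * d" unfolding eq by simp
  then show "d' dvd d"
    using coprime_sifted_small[OF assms(4,2,3)] by (simp add: coprime_dvd_mult_right_iff)
qed

text \<open>Each progression with start \<open>a \<le> n - n div 2\<close> and sifted difference \<open>d \<le> n div (2 * k)\<close> lies in \<open>{1..n}\<close>.
  If none is rainbow, each contains two equally coloured points, say in positions \<open>i\<close> and \<open>i + s\<close>. The two
  points and \<open>i\<close> recover \<open>d\<close> from the distance \<open>s * d\<close>, and then \<open>a\<close>. So the number of progressions is at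
  most \<open>k\<close> times the number \<open>n * m\<close> of ordered pairs of equally coloured points.\<close>
lemma card_sifted_upper_if_no_rainbow:
  assumes k: "k \<ge> 1" and m: "m \<ge> 1" and t: "t \<ge> 1"
    and col: "equinumerous_coloring t m g"
    and none: "\<not> (\<exists>A. A \<subseteq> {1..t * m} \<and> arith_prog k A \<and> rainbow g A)"
  shows "card (sifted (primes_upto k) (t * m div (2 * k))) \<le> 2 * k * m"
proof -
  define n where "n = t * m"
  define X where "X = n div (2 * k)"
  define D where "D = sifted (primes_upto k) X"
  define Mono where "Mono = Sigma {1..n} (\<lambda>x. {y \<in> {1..n}. g y = g x})"
  define \<Omega> where "\<Omega> = {1..n - n div 2} \<times> D"
  have n: "n \<ge> 1" using m t by (simp add: n_def Suc_le_eq)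
  have D: "d \<ge> 1 \<and> d \<le> X" if "d \<in> D" for d using that by (auto simp: D_def sifted_def)
  have inside: "a + i * d \<in> {1..n}" if "a \<in> {1..n - n div 2}" "d \<in> D" "i < k" for a d i
  proof -
    have "i * d \<le> k * X" using that D[of d] by (intro mult_mono) auto
    also have "k * X \<le> n div 2"
    proof -
      have "X * (2 * k) \<le> n" unfolding X_def by (rule div_times_less_eq_dividend)
      then show ?thesis by (simp add: less_eq_div_iff_mult_less_eq ac_simps)
    qed
    finally show ?thesis using that by auto
  qed
  have "\<exists>w \<in> Mono \<times> {..<k}. \<exists>i s. 1 \<le> s \<and> s < k \<and>
          w = ((fst ad + i * snd ad, fst ad + i * snd ad + s * snd ad), i)" if ad_in: "ad \<in> \<Omega>" for ad
  proof -
    obtain a d where ad: "ad = (a, d)" "a \<in> {1..n - n div 2}" "d \<in> D"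
      using ad_in unfolding \<Omega>_def by blast
    define A where "A = {a + i * d | i. i < k}"
    have "A \<subseteq> {1..t * m}" using inside ad unfolding A_def n_def[symmetric] by blast
    moreover have "arith_prog k A" unfolding arith_prog_def A_def using D[OF ad(3)] by blast
    ultimately have "\<not> inj_on g A" using none by (auto simp: rainbow_def)
    then obtain i j where ij: "i < k" "j < k" "g (a + i * d) = g (a + j * d)" "a + i * d \<noteq> a + j * d"
      unfolding inj_on_def A_def by blast
    \<comment> \<open>Order the two positions, so that the distance is \<open>(j - i) * d\<close> with \<open>1 \<le> j - i < k\<close>.\<close>
    have "\<exists>i j. i < j \<and> j < k \<and> g (a + i * d) = g (a + j * d)"
    proof (cases "i < j")
      case False
      then have "j < i" using ij(4) by (cases "i = j") auto
      then show ?thesis using ij by metis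
    qed (use ij in blast)
    then obtain i j where ij: "i < j" "j < k" "g (a + i * d) = g (a + j * d)" by blast
    have j: "a + i * d + (j - i) * d = a + j * d"
      using ij(1) by (simp add: diff_mult_distrib)
    have "((a + i * d, a + i * d + (j - i) * d), i) \<in> Mono \<times> {..<k}"
      unfolding j using ij inside[OF ad(2,3), of i] inside[OF ad(2,3), of j] by (auto simp: Mono_def)
    moreover have "1 \<le> j - i" "j - i < k" using ij by auto
    ultimately show ?thesis unfolding ad(1) fst_conv snd_conv by blast
  qed
  then obtain f where f: "\<And>ad. ad \<in> \<Omega> \<Longrightarrow> f ad \<in> Mono \<times> {..<k} \<and> (\<exists>i s. 1 \<le> s \<and> s < k \<and>
          f ad = ((fst ad + i * snd ad, fst ad + i * snd ad + s * snd ad), i))"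
    by metis
  have "inj_on f \<Omega>"
  proof (rule inj_onI)
    fix u v assume u: "u \<in> \<Omega>" and v: "v \<in> \<Omega>" and eq: "f u = f v"
    obtain a d where ad: "u = (a, d)" by (cases u)
    obtain a' d' where ad': "v = (a', d')" by (cases v)
    have dD: "d \<in> D" "d' \<in> D" using u v by (auto simp: ad ad' \<Omega>_def)
    obtain i s where is1: "1 \<le> s" "s < k" "f u = ((a + i * d, a + i * d + s * d), i)"
      using f[OF u] ad by auto
    obtain i' s' where is2: "1 \<le> s'" "s' < k" "f v = ((a' + i' * d', a' + i' * d' + s' * d'), i')"
      using f[OF v] ad' by auto
    have "i = i'" and x: "a + i * d = a' + i' * d'" and "s * d = s' * d'"
      using eq is1(3) is2(3) by auto
    then have "d = d'"
      using dD is1 is2 unfolding D_def by (intro sifted_factor_unique[of d k X s d' s']) auto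
    with x \<open>i = i'\<close> show "u = v" by (simp add: ad ad')
  qed
  moreover have "f ` \<Omega> \<subseteq> Mono \<times> {..<k}" using f by blast
  moreover have "finite (Mono \<times> {..<k})" by (auto simp: Mono_def)
  ultimately have "card \<Omega> \<le> card (Mono \<times> {..<k})" by (rule card_inj_on_le)
  moreover have "card Mono = n * m"
  proof -
    have "card {y \<in> {1..n}. g y = g x} = m" if "x \<in> {1..n}" for x
      using col that unfolding equinumerous_coloring_def n_def by blast
    then show ?thesis unfolding Mono_def by (subst card_SigmaI) auto
  qed
  ultimately have count: "(n - n div 2) * card D \<le> n * m * k"
    by (simp add: \<Omega>_def card_cartesian_product)
  have "n \<le> 2 * (n - n div 2)" by linarith
  then have "n * card D \<le> 2 * (n - n div 2) * card D" by (rule mult_right_mono) simp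
  also have "\<dots> = 2 * ((n - n div 2) * card D)" by (rule mult.assoc)
  also have "\<dots> \<le> 2 * (n * m * k)" using count by (rule mult_left_mono) simp
  also have "\<dots> = n * (2 * k * m)" by (simp only: ac_simps)
  finally have "n * card D \<le> n * (2 * k * m)" .
  then show ?thesis using n by (simp add: D_def X_def n_def)
qed

text \<open>The constant has two parts: \<open>8 / b\<close> makes the sieve bound contradict the upper bound \<open>2 * k * m\<close>, and
  \<open>2 * 3 ^ 7 / ln 2\<close> makes \<open>t \<ge> 2 * 3 ^ 7 * k\<^sup>2\<close>, so that the differences range far enough for the sieve
  bound to apply for every \<open>m\<close>.\<close>
lemma forces_rainbow_AP_of_large:
  obtains c :: real where "c > 0"
    "\<And>k t. k \<ge> 2 \<Longrightarrow> real t > c * (real k)\<^sup>2 * ln (real k) \<Longrightarrow> forces_rainbow_AP k t"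
proof -
  obtain b where b: "b > 0"
    "\<And>k x. k \<ge> 2 \<Longrightarrow> x \<ge> 3 ^ 7 * k \<Longrightarrow>
       b * real x / ln (real k) \<le> real (card (sifted (primes_upto k) x))"
    using card_sifted_primes_lower by blast
  define c where "c = 8 / b + 2 * 3 ^ 7 / ln 2"
  have ln2: "0 < ln (2::real)" by simp
  have c: "c > 0" using b(1) by (simp add: c_def add_pos_pos)
  moreover have "forces_rainbow_AP k t"
    if k: "k \<ge> 2" and t: "real t > c * (real k)\<^sup>2 * ln (real k)" for k t
    unfolding forces_rainbow_AP_def
  proof (intro allI impI, rule ccontr)
    fix m g
    assume m: "1 \<le> m" and col: "equinumerous_coloring t m g"
      and none: "\<not> (\<exists>A. A \<subseteq> {1..t * m} \<and> arith_prog k A \<and> rainbow g A)"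
    define X where "X = t * m div (2 * k)"
    have lnk: "ln 2 \<le> ln (real k)" "0 < ln (real k)" using k by auto
    have t1: "real t > 8 / b * ((real k)\<^sup>2 * ln (real k))"
    proof -
      have "8 / b * ((real k)\<^sup>2 * ln (real k)) \<le> c * ((real k)\<^sup>2 * ln (real k))"
        using lnk by (intro mult_right_mono) (auto simp: c_def)
      then show ?thesis using t by (simp add: mult.assoc)
    qed
    have "2 * 3 ^ 7 * (real k)\<^sup>2 = 2 * 3 ^ 7 / ln 2 * ((real k)\<^sup>2 * ln 2)" by simp
    also have "\<dots> \<le> c * ((real k)\<^sup>2 * ln (real k))"
      using lnk b(1) c by (intro mult_mono) (auto simp: c_def)
    also have "\<dots> < real t" using t by (simp add: mult.assoc)
    finally have "real (2 * 3 ^ 7 * k\<^sup>2) < real t" by simp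
    then have t2: "2 * 3 ^ 7 * k\<^sup>2 \<le> t" by (simp only: of_nat_less_iff less_imp_le)
    also have "t * 1 \<le> t * m" using m by (intro mult_left_mono) auto
    finally have "3 ^ 7 * k * (2 * k) \<le> t * m" by (simp add: power2_eq_square)
    then have X: "3 ^ 7 * k \<le> X"
      unfolding X_def using k by (subst less_eq_div_iff_mult_less_eq) auto
    then have Xk: "2 * k \<le> t * m" unfolding X_def using k
      by (metis div_less le_zero_eq mult_eq_0_iff not_le_imp_less not_numeral_le_zero power_not_zero zero_neq_numeral)
    have t0: "t \<ge> 1" using t2 k by (cases "t = 0") auto
    have "b * (real (t * m) / (2 * real (2 * k))) / ln (real k) \<le> b * real X / ln (real k)"
      unfolding X_def using Xk k b(1) lnk by (intro divide_right_mono mult_left_mono div_ge_half) auto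
    also have "\<dots> \<le> real (card (sifted (primes_upto k) X))" by (rule b(2)) fact+
    also have "\<dots> \<le> real (2 * k * m)"
      unfolding of_nat_le_iff X_def
      by (rule card_sifted_upper_if_no_rainbow[OF _ m t0 col none]) (use k in simp)
    finally have "b * real t * real m \<le> 8 * (real k)\<^sup>2 * ln (real k) * real m"
      using lnk k by (simp add: field_simps power2_eq_square)
    then have "b * real t \<le> 8 * (real k)\<^sup>2 * ln (real k)" using m by simp
    then show False using t1 b(1) by (simp add: field_simps)
  qed
  ultimately show ?thesis using that by blast
qed

theorem corollary2p4:
  "\<exists>c::real. \<forall>k::nat. k \<ge> 2 \<longrightarrow>
     ereal_of_enat (T k) \<le> ereal (c * (real k)\<^sup>2 * ln (real k))"
proof -
  obtain c where c: "c > 0"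
    "\<And>k t. k \<ge> 2 \<Longrightarrow> real t > c * (real k)\<^sup>2 * ln (real k) \<Longrightarrow> forces_rainbow_AP k t"
    using forces_rainbow_AP_of_large by blast
  have "ereal_of_enat (T k) \<le> ereal ((c + 1 / ln 2) * (real k)\<^sup>2 * ln (real k))" if k: "k \<ge> 2" for k
  proof -
    define x where "x = c * (real k)\<^sup>2 * ln (real k)"
    define t where "t = Suc (nat \<lfloor>x\<rfloor>)"
    have x: "x \<ge> 0" using c(1) k by (simp add: x_def)
    then have t: "x < real t" "real t \<le> x + 1" by (auto simp: t_def) linarith+
    have "forces_rainbow_AP k t" using t(1) k unfolding x_def by (intro c(2))
    then have "T k \<le> enat t" unfolding T_def by (intro Inf_lower) (auto simp: t_def)
    then have "ereal_of_enat (T k) \<le> ereal_of_enat (enat t)" by (simp only: ereal_of_enat_le_iff)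
    also have "\<dots> \<le> ereal (x + 1)" using t(2) by simp
    also have "\<dots> \<le> ereal ((c + 1 / ln 2) * (real k)\<^sup>2 * ln (real k))"
    proof -
      \<comment> \<open>Rounding up to an integer costs at most \<open>1\<close>, which the term \<open>1 / ln 2\<close> pays for as \<open>k \<ge> 2\<close>.\<close>
      have "1 * ln 2 \<le> (real k)\<^sup>2 * ln (real k)"
        using k by (intro mult_mono) auto
      then have "1 \<le> 1 / ln 2 * ((real k)\<^sup>2 * ln (real k))" by (simp add: field_simps)
      then show ?thesis by (simp add: x_def algebra_simps)
    qed
    finally show ?thesis .
  qed
  then show ?thesis by blast
qed

end
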